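(* Let $d\ge 2$ be an integer, let $\varepsilon>0$, and put $n=\lceil 1/\varepsilon\rceil$. Suppose it is known in advance that the (otherwise unknown) collection of preference sets $\{A_{ij}\}_{i,j\in\{1,\ldots,d\}}$ on the simplex $A$ has the following property: each $A_{ij}$ is a proper subset of $A$, is the intersection of $A$ and a closed half-space with boundary hyperplane parallel to the facet $F_j$, and satisfies $v_j\in A_{ij}$. Then an $\varepsilon$-fair division point can be found in binary mode using at most $$(d-1)^2\left\lceil \log_2\big(n\cdot(d-1)\big)\right\rceil$$ queries. That is, there is an adaptive algorithm in binary mode which, for every collection with this property, makes at most this many queries and outputs an $\varepsilon$-fair division point.
   Context: Let $A$ be a $(d-1)$-dimensional regular simplex with edges of Euclidean length $1$ in $\mathbb{R}^{d-1}$, with vertices $v_1,\ldots,v_d$. Each $x\in A$ is written in barycentric coordinates as $x=[\alpha_1,\ldots,\alpha_d]=\sum_i\alpha_i v_i$ with $\alpha_i\ge 0$, $\sum_i\alpha_i=1$. The facet $F_j$ is the convex hull of $\{v_k\}_{k\ne j}$, so hyperplanes parallel to $F_j$ are those of the form $\{\alpha_j=\text{const}\}$. The metric is $\operatorname{dist}([\alpha_1,\ldots,\alpha_d],[\alpha'_1,\ldots,\alpha'_d])=\max_i|\alpha_i-\alpha'_i|$ (extended to $\mathbb{R}^{d-1}$ by the same formula in affine barycentric coordinates). Preference sets: a collection $\{A_{ij}\}_{i,j\in\{1,\ldots,d\}}$ of closed subsets of $A$ such that for each $i$ (an agent) $\bigcup_{j=1}^d A_{ij}=A$. For $\varepsilon\ge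 0$ put $A^{\varepsilon}_{ij}=\{x\in\mathbb{R}^{d-1}:\operatorname{dist}(x,A_{ij})\le\varepsilon\}$. A point $x\in A$ is an $\varepsilon$-fair division point if there is a permutation $\sigma$ of $\{1,\ldots,d\}$ with $x\in A^{\varepsilon}_{i\sigma(i)}$ for all $i$. Query model: the sets $A_{ij}$ are fixed but unknown to the algorithm. A query in binary mode consists of choosing indices $i,j\in\{1,\ldots,d\}$ and a point $x\in A$; the answer is "yes" if $x\in A_{ij}$ and "no" otherwise. Each query may depend on the previous answers, and after its queries the algorithm outputs a point of $A$ depending only on $d$, $\varepsilon$ and the answers received. Only the number of queries is counted. *)

theory Defs
  imports "HOL-Analysis.Analysis" "HOL-Combinatorics.Permutations"
begin

definition regular_simplex :: "nat \<Rightarrow> (nat \<Rightarrow> 'a::euclidean_space) \<Rightarrow> bool" where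
  "regular_simplex d v \<longleftrightarrow>
     (\<forall>i\<in>{1..d}. \<forall>j\<in>{1..d}. i \<noteq> j \<longrightarrow> dist (v i) (v j) = 1)"

definition simplex_body :: "nat \<Rightarrow> (nat \<Rightarrow> 'a::euclidean_space) \<Rightarrow> 'a set" where
  "simplex_body d v = convex hull (v ` {1..d})"

definition facet :: "nat \<Rightarrow> (nat \<Rightarrow> 'a::euclidean_space) \<Rightarrow> nat \<Rightarrow> 'a set" where
  "facet d v j = convex hull (v ` ({1..d} - {j}))"

text \<open>Affine barycentric coordinates of an arbitrary point of the space (negative values are
  possible). They exist and are unique when the \<open>d\<close> vertices are affinely independent and the
  space has dimension \<open>d - 1\<close>; outside the index range they are fixed to \<open>0\<close>.\<close>

definition bary :: "nat \<Rightarrow> (nat \<Rightarrow> 'a::euclidean_space) \<Rightarrow> 'a \<Rightarrow> nat \<Rightarrow> real" where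
  "bary d v x = (THE a. (\<forall>i. i \<notin> {1..d} \<longrightarrow> a i = 0) \<and> (\<Sum>i\<in>{1..d}. a i) = 1
                       \<and> (\<Sum>i\<in>{1..d}. a i *\<^sub>R v i) = x)"

definition bary_dist :: "nat \<Rightarrow> (nat \<Rightarrow> 'a::euclidean_space) \<Rightarrow> 'a \<Rightarrow> 'a \<Rightarrow> real" where
  "bary_dist d v x y = (MAX i\<in>{1..d}. \<bar>bary d v x i - bary d v y i\<bar>)"

text \<open>The distance to the empty set is regarded as infinite, hence the condition \<open>S \<noteq> {}\<close>.\<close>

definition thickening ::
    "nat \<Rightarrow> (nat \<Rightarrow> 'a::euclidean_space) \<Rightarrow> real \<Rightarrow> 'a set \<Rightarrow> 'a set" where
  "thickening d v \<epsilon> S = {x. S \<noteq> {} \<and> (INF y\<in>S. bary_dist d v x y) \<le> \<epsilon>}"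

text \<open>\<open>P i j\<close> is the set of divisions for which agent \<open>i\<close> accepts piece \<open>j\<close>; only indices in
  \<open>{1..d}\<close> are relevant.\<close>

definition preference_sets ::
    "nat \<Rightarrow> (nat \<Rightarrow> 'a::euclidean_space) \<Rightarrow> (nat \<Rightarrow> nat \<Rightarrow> 'a set) \<Rightarrow> bool" where
  "preference_sets d v P \<longleftrightarrow>
     (\<forall>i\<in>{1..d}. \<forall>j\<in>{1..d}. closed (P i j) \<and> P i j \<subseteq> simplex_body d v) \<and>
     (\<forall>i\<in>{1..d}. (\<Union>j\<in>{1..d}. P i j) = simplex_body d v)"

definition eps_fair_division ::
    "nat \<Rightarrow> (nat \<Rightarrow> 'a::euclidean_space) \<Rightarrow> real \<Rightarrow> (nat \<Rightarrow> nat \<Rightarrow> 'a set) \<Rightarrow> 'a \<Rightarrow> bool" where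
  "eps_fair_division d v \<epsilon> P x \<longleftrightarrow> x \<in> simplex_body d v \<and>
     (\<exists>\<sigma>. \<sigma> permutes {1..d} \<and> (\<forall>i\<in>{1..d}. x \<in> thickening d v \<epsilon> (P i (\<sigma> i))))"

definition halfspace_parallel_to_facet ::
    "nat \<Rightarrow> (nat \<Rightarrow> 'a::euclidean_space) \<Rightarrow> nat \<Rightarrow> 'a set \<Rightarrow> bool" where
  "halfspace_parallel_to_facet d v j H \<longleftrightarrow>
     (\<exists>a c. a \<noteq> 0 \<and> H = {x. a \<bullet> x \<le> c} \<and>
            affine_parallel (affine hull (facet d v j)) {x. a \<bullet> x = c})"

definition halfspace_preferences ::
    "nat \<Rightarrow> (nat \<Rightarrow> 'a::euclidean_space) \<Rightarrow> (nat \<Rightarrow> nat \<Rightarrow> 'a set) \<Rightarrow> bool" where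
  "halfspace_preferences d v P \<longleftrightarrow>
     (\<forall>i\<in>{1..d}. \<forall>j\<in>{1..d}.
        P i j \<subset> simplex_body d v \<and>
        (\<exists>H. halfspace_parallel_to_facet d v j H \<and> P i j = simplex_body d v \<inter> H) \<and>
        v j \<in> P i j)"

text \<open>A deterministic adaptive algorithm in binary mode is a decision tree:
  \<open>Query i j x t f\<close> asks whether \<open>x\<close> lies in the set with indices \<open>i\<close>, \<open>j\<close>, and continues
  with \<open>t\<close> on the answer ``yes'' and with \<open>f\<close> on the answer ``no''.\<close>

datatype 'a algorithm =
    Output 'a
  | Query nat nat 'a "'a algorithm" "'a algorithm"

primrec admissible :: "nat \<Rightarrow> (nat \<Rightarrow> 'a::euclidean_space) \<Rightarrow> 'a algorithm \<Rightarrow> bool" where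
  "admissible d v (Output x) \<longleftrightarrow> x \<in> simplex_body d v"
| "admissible d v (Query i j x t f) \<longleftrightarrow>
     i \<in> {1..d} \<and> j \<in> {1..d} \<and> x \<in> simplex_body d v \<and> admissible d v t \<and> admissible d v f"

primrec result :: "(nat \<Rightarrow> nat \<Rightarrow> 'a set) \<Rightarrow> 'a algorithm \<Rightarrow> 'a" where
  "result P (Output x) = x"
| "result P (Query i j x t f) = (if x \<in> P i j then result P t else result P f)"

primrec num_queries :: "(nat \<Rightarrow> nat \<Rightarrow> 'a set) \<Rightarrow> 'a algorithm \<Rightarrow> nat" where
  "num_queries P (Output x) = 0"
| "num_queries P (Query i j x t f) =
     Suc (if x \<in> P i j then num_queries P t else num_queries P f)"

end

theory Submission
  imports Defs
begin

text \<open>Each preference set has the form \<open>P i j = {x \<in> A. c i j \<le> x\<^sub>j}\<close> with \<open>0 < c i j \<le> 1\<close>, and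
  covering gives \<open>(\<Sum>j. c i j) \<le> 1\<close> for every agent. Bisection finds the \<open>(d - 1)\<^sup>2\<close> thresholds
  with \<open>i, j < d\<close> up to \<open>2\<^sup>-\<^sup>M\<close>, and \<open>1 - (\<Sum>j<d. c i j)\<close> serves as a bound for \<open>c i d\<close>. Agent \<open>d\<close>
  is never asked: \<open>x\<close> is chosen so that, whichever piece agent \<open>d\<close> takes, the other agents can
  be matched to the remaining pieces.

  To find such an \<open>x\<close> for costs \<open>b i j\<close> with row sums \<open>K\<close>, choose prices \<open>y\<close> that maximise
  \<open>d * (\<Sum>i<d. Min\<^sub>j (b i j + y j)) - (d - 1) * (\<Sum>j. y j)\<close>. Raising by one the prices of all
  pieces that are cheapest for some agent of a set \<open>S\<close> does not increase this value, so there are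
  more than \<open>card S\<close> such pieces, and Hall's theorem provides the matchings along cheapest pieces
  even after one piece is removed. With \<open>x\<^sub>j = s - y j\<close> normalised to total \<open>K\<close>, the
  cheapest value of \<open>b i j - x\<^sub>j\<close> is at most the average \<open>0\<close>.\<close>

section \<open>Matchings: Hall's theorem and demand sets with surplus\<close>

text \<open>Induction on the number of agents. If a nonempty proper subfamily \<open>S\<close> is
  tight, it is matched inside its union \<open>?U\<close>, and what the others have outside
  \<open>?U\<close> still satisfies Hall's condition, as counting \<open>T \<union> S\<close> shows.
  If none is tight, every nonempty proper subfamily has an element to spare, so one agent may take
  any \<open>x\<close> of its set.\<close>

lemma hall_marriage:
  assumes "finite I" and "\<And>i. i \<in> I \<Longrightarrow> finite (A i)"
    and "\<And>S. S \<subseteq> I \<Longrightarrow> card S \<le> card (\<Union>(A ` S))"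
  shows "\<exists>m. inj_on m I \<and> (\<forall>i\<in>I. m i \<in> A i)"
  using assms
proof (induction "card I" arbitrary: I A rule: less_induct)
  case less
  note finI = less.prems(1) and finA = less.prems(2) and hall = less.prems(3)
  show ?case
  proof (cases "I = {}")
    case True
    then show ?thesis by simp
  next
    case False
    show ?thesis
    proof (cases "\<exists>S. S \<noteq> {} \<and> S \<subset> I \<and> card (\<Union>(A ` S)) = card S")
      case True
      then obtain S where S: "S \<noteq> {}" "S \<subset> I" and tight: "card (\<Union>(A ` S)) = card S"
        by blast
      let ?U = "\<Union>(A ` S)"
      have finS: "finite S" using S finI finite_subset by blast
      have "card S < card I" using S finI by (simp add: psubset_card_mono)
      then have "\<exists>m. inj_on m S \<and> (\<forall>i\<in>S. m i \<in> A i)"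
        by (rule less.hyps) (use finS finA hall S in auto)
      then obtain m1 where m1: "inj_on m1 S" "\<And>i. i \<in> S \<Longrightarrow> m1 i \<in> A i"
        by blast
      have smaller: "card (I - S) < card I"
        using S finI by (intro psubset_card_mono) auto
      have hall': "card T \<le> card (\<Union>((\<lambda>k. A k - ?U) ` T))" if T: "T \<subseteq> I - S" for T
      proof -
        have finT: "finite T" using T finI finite_subset by blast
        have "card T + card S = card (T \<union> S)"
          using T finT finS by (subst card_Un_disjoint) auto
        also have "\<dots> \<le> card (\<Union>(A ` (T \<union> S)))"
          using T S by (intro hall) auto
        also have "\<Union>(A ` (T \<union> S)) = \<Union>((\<lambda>k. A k - ?U) ` T) \<union> ?U"
          by auto
        also have "card \<dots> \<le> card (\<Union>((\<lambda>k. A k - ?U) ` T)) + card S"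
          using tight card_Un_le by metis
        finally show ?thesis by simp
      qed
      have "\<exists>m. inj_on m (I - S) \<and> (\<forall>i\<in>I - S. m i \<in> A i - ?U)"
        by (rule less.hyps[OF smaller]) (use finI finA hall' in auto)
      then obtain m2 where m2: "inj_on m2 (I - S)" "\<And>i. i \<in> I - S \<Longrightarrow> m2 i \<in> A i - ?U"
        by blast
      let ?m = "\<lambda>i. if i \<in> S then m1 i else m2 i"
      have "m1 i \<noteq> m2 k" if "i \<in> S" "k \<in> I - S" for i k
        using m1(2)[OF that(1)] m2(2)[OF that(2)] that(1) by (metis DiffD2 UN_I)
      then have "inj_on ?m I"
        using m1(1) m2(1) by (simp add: inj_on_def) metis
      moreover have "?m i \<in> A i" if "i \<in> I" for i
        using m1(2)[of i] m2(2)[of i] that by simp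
      ultimately show ?thesis by blast
    next
      case noTight: False
      obtain i where i: "i \<in> I" using False by blast
      have "A i \<noteq> {}" using hall[of "{i}"] i by auto
      then obtain x where x: "x \<in> A i" by blast
      have smaller: "card (I - {i}) < card I" using i finI by (rule card_Diff1_less[rotated])
      have hall': "card T \<le> card (\<Union>((\<lambda>k. A k - {x}) ` T))" if T: "T \<subseteq> I - {i}" for T
      proof (cases "T = {}")
        case False
        have "card T \<le> card (\<Union>(A ` T))" using T by (intro hall) auto
        moreover have "card (\<Union>(A ` T)) \<noteq> card T"
          using noTight False T i by blast
        ultimately have "card T \<le> card (\<Union>(A ` T)) - 1" by linarith
        also have "\<dots> \<le> card (\<Union>(A ` T) - {x})"
          using diff_card_le_card_Diff[of "{x}"] by simp
        also have "\<Union>(A ` T) - {x} = \<Union>((\<lambda>k. A k - {x}) ` T)" by auto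
        finally show ?thesis .
      qed simp
      have "\<exists>m. inj_on m (I - {i}) \<and> (\<forall>k\<in>I - {i}. m k \<in> A k - {x})"
        by (rule less.hyps[OF smaller]) (use finI finA hall' in auto)
      then obtain m where m: "inj_on m (I - {i})" "\<forall>k\<in>I - {i}. m k \<in> A k - {x}"
        by blast
      have "inj_on (m(i := x)) I"
        using m by (auto simp: inj_on_def)
      moreover have "\<forall>k\<in>I. (m(i := x)) k \<in> A k"
        using m x by auto
      ultimately show ?thesis by blast
    qed
  qed
qed

definition cheapest :: "('i \<Rightarrow> 'j \<Rightarrow> int) \<Rightarrow> ('j \<Rightarrow> int) \<Rightarrow> 'j set \<Rightarrow> 'i \<Rightarrow> 'j set" where
  "cheapest b y J i = {j \<in> J. \<forall>k\<in>J. b i j + y j \<le> b i k + y k}"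

text \<open>\<open>f\<close> is the dual objective of the transportation problem in which every
  agent ships \<open>card J\<close> units and every piece receives \<open>card I\<close> units. At a
  maximiser, raising the prices on the union \<open>N\<close> of the demand sets of \<open>S\<close>
  cannot help, so \<open>card J * card S \<le> card I * card N\<close>; as \<open>card J\<close>
  exceeds \<open>card I\<close>, \<open>N\<close> is larger than \<open>S\<close>.\<close>

lemma ex_cheapest_surplus:
  fixes b :: "'i \<Rightarrow> 'j \<Rightarrow> int"
  assumes "finite I" and "finite J" and cardJ: "card J = Suc (card I)"
  obtains y where "\<And>S. S \<subseteq> I \<Longrightarrow> S \<noteq> {} \<Longrightarrow> card S < card (\<Union>(cheapest b y J ` S))"
proof -
  have J: "J \<noteq> {}" using cardJ by auto
  define \<mu> where "\<mu> y i = Min ((\<lambda>j. b i j + y j) ` J)" for y i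
  define f where "f y = int (card J) * (\<Sum>i\<in>I. \<mu> y i) - int (card I) * (\<Sum>j\<in>J. y j)" for y
  have \<mu>_le: "\<mu> y i \<le> b i j + y j" if "j \<in> J" for y i j
    unfolding \<mu>_def using that \<open>finite J\<close> by auto
  have \<mu>_ge: "c \<le> \<mu> y i" if "\<And>j. j \<in> J \<Longrightarrow> c \<le> b i j + y j" for c y i
    unfolding \<mu>_def using that \<open>finite J\<close> J by auto
  define B where "B = (\<Sum>i\<in>I. \<Sum>j\<in>J. b i j)"
  \<comment> \<open>Weak duality against the plan that ships one unit along every pair, at cost
    \<open>B\<close>.\<close>
  have f_le: "f y \<le> B" for y
  proof -
    have "int (card J) * \<mu> y i \<le> (\<Sum>j\<in>J. b i j + y j)" for i
      using sum_mono[of J "\<lambda>_. \<mu> y i" "\<lambda>j. b i j + y j"] \<mu>_le by simp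
    then have "(\<Sum>i\<in>I. int (card J) * \<mu> y i) \<le> (\<Sum>i\<in>I. \<Sum>j\<in>J. b i j + y j)"
      by (intro sum_mono)
    then show ?thesis
      by (simp add: f_def B_def sum.distrib sum_distrib_left)
  qed
  \<comment> \<open>An integer-valued function bounded above attains its maximum; by
    \<open>f_le\<close>, \<open>nat\<close> does not truncate \<open>B - f z\<close>.\<close>
  obtain y where "\<And>z. nat (B - f y) \<le> nat (B - f z)"
    using ex_has_least_nat[of "\<lambda>_. True" undefined "\<lambda>z. nat (B - f z)"] by auto
  then have y_max: "f z \<le> f y" for z
    using f_le[of z] f_le[of y] by (smt (verit) nat_le_eq_zle)
  have "card S < card (\<Union>(cheapest b y J ` S))" if S: "S \<subseteq> I" "S \<noteq> {}" for S
  proof -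
    define N where "N = \<Union>(cheapest b y J ` S)"
    have NJ: "N \<subseteq> J" by (auto simp: N_def cheapest_def)
    define z where "z j = y j + of_bool (j \<in> N)" for j
    have "\<mu> y i + of_bool (i \<in> S) \<le> \<mu> z i" for i
    proof (rule \<mu>_ge)
      fix j assume j: "j \<in> J"
      show "\<mu> y i + of_bool (i \<in> S) \<le> b i j + z j"
      proof (cases "i \<in> S \<and> j \<notin> N")
        case True
        \<comment> \<open>Integrality puts a piece that is not cheapest at least one above the
          minimum, so raising \<open>N\<close> alone lifts the minimum of an agent of
          \<open>S\<close> by a full unit.\<close>
        then have "j \<notin> cheapest b y J i" by (auto simp: N_def)
        then obtain k where "k \<in> J" "b i k + y k < b i j + y j"
          using j by (force simp: cheapest_def)
        then show ?thesis
          using \<mu>_le[of k y i] True by (simp add: z_def)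
      next
        case False
        then show ?thesis
          using \<mu>_le[OF j, of y i] by (auto simp: z_def)
      qed
    qed
    then have "(\<Sum>i\<in>I. \<mu> y i + of_bool (i \<in> S)) \<le> (\<Sum>i\<in>I. \<mu> z i)"
      by (intro sum_mono)
    moreover have "(\<Sum>i\<in>I. of_bool (i \<in> S)) = int (card S)"
      using S \<open>finite I\<close> by (simp add: sum.If_cases of_bool_def Int_absorb1)
    ultimately have gain: "(\<Sum>i\<in>I. \<mu> y i) + int (card S) \<le> (\<Sum>i\<in>I. \<mu> z i)"
      by (simp add: sum.distrib)
    have sumz: "(\<Sum>j\<in>J. z j) = (\<Sum>j\<in>J. y j) + int (card N)"
      using NJ \<open>finite J\<close> by (simp add: z_def sum.distrib of_bool_def sum.If_cases Int_absorb1)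
    have "int (card J) * ((\<Sum>i\<in>I. \<mu> y i) + int (card S)) \<le> int (card J) * (\<Sum>i\<in>I. \<mu> z i)"
      using gain by (intro mult_left_mono) auto
    then have "int (card J) * int (card S) \<le> int (card I) * int (card N)"
      using y_max[of z] unfolding f_def sumz by (simp add: algebra_simps)
    then have "card J * card S \<le> card I * card N"
      by (metis of_nat_le_iff of_nat_mult)
    moreover have "0 < card S"
      using S \<open>finite I\<close> by (meson card_gt_0_iff finite_subset)
    ultimately have "card I * card S < card I * card N"
      unfolding cardJ mult_Suc by linarith
    then show ?thesis
      unfolding N_def by simp
  qed
  then show thesis using that by blast
qed

text \<open>\<open>k\<close> stands for the piece that the agent outside \<open>I\<close> takes
  later, so \<open>x\<close> is fixed before \<open>k\<close>. Deleting \<open>k\<close> costs a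
  union of demand sets at most one element, and the strict surplus pays for it.\<close>

lemma ex_fair_for_undecided_agent:
  fixes b :: "'i \<Rightarrow> 'j \<Rightarrow> int" and K :: int
  assumes "finite I" and "finite J" and cardJ: "card J = Suc (card I)" and "I \<noteq> {}"
    and b_nonneg: "\<And>i j. i \<in> I \<Longrightarrow> j \<in> J \<Longrightarrow> 0 \<le> b i j"
    and b_sum: "\<And>i. i \<in> I \<Longrightarrow> (\<Sum>j\<in>J. b i j) = K"
  shows "\<exists>x :: 'j \<Rightarrow> real. (\<forall>j\<in>J. 0 \<le> x j) \<and> (\<Sum>j\<in>J. x j) = K \<and>
    (\<forall>k\<in>J. \<exists>m. bij_betw m I (J - {k}) \<and> (\<forall>i\<in>I. b i (m i) \<le> x (m i)))"
proof -
  obtain y where y: "\<And>S. S \<subseteq> I \<Longrightarrow> S \<noteq> {} \<Longrightarrow> card S < card (\<Union>(cheapest b y J ` S))"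
    using ex_cheapest_surplus[OF assms(1,2) cardJ] by blast
  define s where "s = (real_of_int K + (\<Sum>j\<in>J. real_of_int (y j))) / real (card J)"
  define x where "x j = s - y j" for j
  have cJ: "real (card J) > 0" using cardJ by simp
  have x_sum: "(\<Sum>j\<in>J. x j) = K"
    using cJ by (simp add: x_def s_def sum_subtractf)
  have cheap: "b i j \<le> x j" if "i \<in> I" "j \<in> cheapest b y J i" for i j
  proof -
    have "(\<Sum>k\<in>J. b i j + y j) \<le> (\<Sum>k\<in>J. b i k + y k)"
      using that by (intro sum_mono) (auto simp: cheapest_def)
    then have "int (card J) * (b i j + y j) \<le> K + (\<Sum>k\<in>J. y k)"
      using b_sum[OF that(1)] by (simp add: sum.distrib)
    then have "real_of_int (int (card J) * (b i j + y j)) \<le> real_of_int (K + (\<Sum>k\<in>J. y k))"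
      by linarith
    then have "(real_of_int (b i j) + y j) * real (card J) \<le> K + (\<Sum>k\<in>J. real_of_int (y k))"
      by (simp add: mult.commute)
    then show ?thesis
      using cJ by (simp add: x_def s_def pos_le_divide_eq le_diff_eq)
  qed
  have match: "\<exists>m. bij_betw m I (J - {k}) \<and> (\<forall>i\<in>I. m i \<in> cheapest b y J i)" if k: "k \<in> J" for k
  proof -
    have "\<exists>m. inj_on m I \<and> (\<forall>i\<in>I. m i \<in> cheapest b y J i - {k})"
    proof (rule hall_marriage[OF \<open>finite I\<close>])
      show "finite (cheapest b y J i - {k})" for i
        using \<open>finite J\<close> by (simp add: cheapest_def)
      fix S assume S: "S \<subseteq> I"
      show "card S \<le> card (\<Union>((\<lambda>i. cheapest b y J i - {k}) ` S))"
      proof (cases "S = {}")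
        case False
        have "card S \<le> card (\<Union>(cheapest b y J ` S)) - 1"
          using y[OF S False] by simp
        also have "\<dots> \<le> card (\<Union>(cheapest b y J ` S) - {k})"
          using diff_card_le_card_Diff[of "{k}"] by simp
        also have "\<Union>(cheapest b y J ` S) - {k} = \<Union>((\<lambda>i. cheapest b y J i - {k}) ` S)"
          by auto
        finally show ?thesis .
      qed simp
    qed
    then obtain m where m: "inj_on m I" "\<And>i. i \<in> I \<Longrightarrow> m i \<in> cheapest b y J i - {k}"
      by blast
    have "m ` I \<subseteq> J - {k}" using m(2) by (auto simp: cheapest_def)
    moreover have "card (m ` I) = card (J - {k})"
      using card_image[OF m(1)] cardJ k \<open>finite J\<close> by simp
    ultimately have "m ` I = J - {k}"
      using \<open>finite J\<close> by (simp add: card_subset_eq)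
    then show ?thesis using m by (auto simp: bij_betw_def)
  qed
  \<comment> \<open>Leaving out some \<open>k \<noteq> j\<close> forces \<open>j\<close> to be
    matched; the cost of its agent there is nonnegative and at most \<open>x j\<close>.\<close>
  have "0 \<le> x j" if j: "j \<in> J" for j
  proof -
    have "J \<noteq> {j}" using cardJ \<open>I \<noteq> {}\<close> \<open>finite I\<close> by auto
    then obtain k where k: "k \<in> J" "k \<noteq> j" using j by blast
    then obtain m where m: "bij_betw m I (J - {k})" "\<forall>i\<in>I. m i \<in> cheapest b y J i"
      using match by blast
    then obtain i where "i \<in> I" "m i = j"
      using j k by (metis DiffI bij_betw_iff_bijections singletonD)
    then show ?thesis
      using m(2) cheap[of i j] b_nonneg[of i j] j by force
  qed
  moreover have "\<exists>m. bij_betw m I (J - {k}) \<and> (\<forall>i\<in>I. b i (m i) \<le> x (m i))" if "k \<in> J" for k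
    using match[OF that] cheap by blast
  ultimately show ?thesis using x_sum by blast
qed

section \<open>Decision trees that bisect for thresholds\<close>

text \<open>The threshold is kept in the interval from \<open>lo\<close> (excluded) to
  \<open>lo + 2 ^ s\<close> (included), since a yes allows equality. The continuation
  \<open>cont\<close> receives the final lower end and supplies the rest of the tree.\<close>

primrec bisect ::
  "nat \<Rightarrow> nat \<Rightarrow> nat \<Rightarrow> (nat \<Rightarrow> 'a) \<Rightarrow> (nat \<Rightarrow> 'a algorithm) \<Rightarrow> nat \<Rightarrow> 'a algorithm" where
  "bisect i j 0 pt cont lo = cont lo"
| "bisect i j (Suc s) pt cont lo =
     Query i j (pt (lo + 2 ^ s)) (bisect i j s pt cont lo) (bisect i j s pt cont (lo + 2 ^ s))"

lemma admissible_bisect: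
  assumes "i \<in> {1..d}" and "j \<in> {1..d}"
    and "\<And>k. lo \<le> k \<Longrightarrow> k \<le> lo + 2 ^ s \<Longrightarrow> pt k \<in> simplex_body d v"
    and "\<And>k. admissible d v (cont k)"
  shows "admissible d v (bisect i j s pt cont lo)"
  using assms by (induction s arbitrary: lo) auto

text \<open>The \<open>2 ^ s\<close> unit cells are halved \<open>s\<close> times. No query is spent
  on the two ends, because the bounds on \<open>c\<close> already decide them.\<close>

lemma bisect_threshold:
  fixes c :: real
  assumes "\<And>k. lo \<le> k \<Longrightarrow> k \<le> lo + 2 ^ s \<Longrightarrow> pt k \<in> P i j \<longleftrightarrow> c \<le> real k"
    and "real lo < c" and "c \<le> real (lo + 2 ^ s)"
  shows "\<exists>k. real k < c \<and> c \<le> real k + 1 \<and>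
           result P (bisect i j s pt cont lo) = result P (cont k) \<and>
           num_queries P (bisect i j s pt cont lo) = s + num_queries P (cont k)"
  using assms
proof (induction s arbitrary: lo)
  case 0
  then show ?case by auto
next
  case (Suc s)
  show ?case
  proof (cases "c \<le> real (lo + 2 ^ s)")
    case True
    moreover have "pt (lo + 2 ^ s) \<in> P i j"
      using True Suc.prems(1) by simp
    ultimately show ?thesis
      using Suc.IH[of lo] Suc.prems by simp
  next
    case False
    moreover have "pt (lo + 2 ^ s) \<notin> P i j"
      using False Suc.prems(1) by simp
    ultimately show ?thesis
      using Suc.IH[of "lo + 2 ^ s"] Suc.prems by (simp add: algebra_simps)
  qed
qed

text \<open>Chaining by continuations: each leaf of one bisection carries the tree for the remaining
  pairs, with the lower ends found so far in \<open>l\<close>. Query points depend on the piece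
  alone and are shared by all agents.\<close>

primrec measure_all ::
  "nat \<Rightarrow> (nat \<Rightarrow> nat \<Rightarrow> 'a) \<Rightarrow> ((nat \<times> nat \<Rightarrow> nat) \<Rightarrow> 'a) \<Rightarrow> (nat \<times> nat) list \<Rightarrow>
     (nat \<times> nat \<Rightarrow> nat) \<Rightarrow> 'a algorithm" where
  "measure_all M pt out [] l = Output (out l)"
| "measure_all M pt out (q # qs) l =
     bisect (fst q) (snd q) M (pt (snd q)) (\<lambda>k. measure_all M pt out qs (l(q := k))) 0"

lemma admissible_measure_all:
  assumes "set qs \<subseteq> {1..d} \<times> {1..d}"
    and "\<And>j k. j \<in> {1..d} \<Longrightarrow> k \<le> 2 ^ M \<Longrightarrow> pt j k \<in> simplex_body d v"
    and "\<And>l. out l \<in> simplex_body d v"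
  shows "admissible d v (measure_all M pt out qs l)"
  using assms(1)
proof (induction qs arbitrary: l)
  case Nil
  then show ?case using assms(3) by simp
next
  case (Cons q qs)
  then show ?case
    using assms(2) by (auto intro!: admissible_bisect)
qed

text \<open>The clause on pairs outside \<open>set qs\<close> serves the induction: with
  distinctness it keeps later measurements from overwriting the entry just found.\<close>

lemma measure_all_thresholds:
  fixes c :: "nat \<Rightarrow> nat \<Rightarrow> real"
  assumes "distinct qs"
    and "\<And>i j k. (i, j) \<in> set qs \<Longrightarrow> k \<le> 2 ^ M \<Longrightarrow> pt j k \<in> P i j \<longleftrightarrow> c i j \<le> real k"
    and "\<And>i j. (i, j) \<in> set qs \<Longrightarrow> 0 < c i j \<and> c i j \<le> 2 ^ M"
  shows "\<exists>l'. (\<forall>i j. (i, j) \<in> set qs \<longrightarrow>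
                 real (l' (i, j)) < c i j \<and> c i j \<le> real (l' (i, j)) + 1) \<and>
           (\<forall>q. q \<notin> set qs \<longrightarrow> l' q = l q) \<and>
           result P (measure_all M pt out qs l) = out l' \<and>
           num_queries P (measure_all M pt out qs l) = length qs * M"
  using assms
proof (induction qs arbitrary: l)
  case Nil
  then show ?case by auto
next
  case (Cons q qs)
  obtain i j where q: "q = (i, j)" by (cases q)
  define cont where "cont = (\<lambda>k. measure_all M pt out qs (l(q := k)))"
  obtain k where k: "real k < c i j" "c i j \<le> real k + 1"
      "result P (bisect i j M (pt j) cont 0) = result P (cont k)"
      "num_queries P (bisect i j M (pt j) cont 0) = M + num_queries P (cont k)"
    using bisect_threshold[of 0 M "pt j" P i j "c i j" cont] Cons.prems q by auto
  obtain l' where l': "\<And>i j. (i, j) \<in> set qs \<Longrightarrow>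
        real (l' (i, j)) < c i j \<and> c i j \<le> real (l' (i, j)) + 1"
      "\<And>r. r \<notin> set qs \<Longrightarrow> l' r = (l(q := k)) r"
      "result P (cont k) = out l'" "num_queries P (cont k) = length qs * M"
    using Cons.IH[of "l(q := k)"] Cons.prems unfolding cont_def
    by (metis distinct.simps(2) list.set_intros(2))
  have "l' (i, j) = k"
    using l'(2)[of q] Cons.prems(1) q by simp
  then show ?case
    using k l' Cons.prems(1) q
    by (intro exI[of _ l']) (auto simp: cont_def)
qed

section \<open>Barycentric coordinates of the regular simplex\<close>

locale full_regular_simplex =
  fixes d :: nat and v :: "nat \<Rightarrow> 'a::euclidean_space"
  assumes d_ge_2: "d \<ge> 2" and dim: "DIM('a) = d - 1" and regular: "regular_simplex d v"
begin

lemma dist_vertices: "i \<in> {1..d} \<Longrightarrow> j \<in> {1..d} \<Longrightarrow> dist (v i) (v j) = of_bool (i \<noteq> j)"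
  using regular by (auto simp: regular_simplex_def)

lemma inj_vertices: "inj_on v {1..d}"
  using dist_vertices by (force simp: inj_on_def)

text \<open>Pairing the relation \<open>(\<Sum>j. a j *\<^sub>R v j) = 0\<close> with \<open>v i\<close> gives
  \<open>a i = - (\<Sum>j. a j * (v j \<bullet> v j))\<close>, so all coefficients are equal.\<close>

lemma vertices_independent:
  assumes a0: "(\<Sum>i\<in>{1..d}. a i) = 0" and av: "(\<Sum>i\<in>{1..d}. a i *\<^sub>R v i) = 0" and i: "i \<in> {1..d}"
  shows "a i = 0"
proof -
  let ?I = "{1..d}"
  have inner_v: "v i \<bullet> v j = ((v i \<bullet> v i) + (v j \<bullet> v j) - of_bool (i \<noteq> j)) / 2"
    if "i \<in> ?I" "j \<in> ?I" for i j
  proof -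
    have "(dist (v i) (v j))\<^sup>2 = of_bool (i \<noteq> j)"
      using dist_vertices[OF that] by simp
    then show ?thesis
      by (simp add: dist_norm power2_norm_eq_inner inner_diff inner_commute)
  qed
  have row: "(\<Sum>j\<in>?I. a j * (v i \<bullet> v j)) = ((\<Sum>j\<in>?I. a j * (v j \<bullet> v j)) + a i) / 2"
    if i: "i \<in> ?I" for i
  proof -
    have "(\<Sum>j\<in>?I. a j * (v i \<bullet> v j)) =
        (\<Sum>j\<in>?I. (a j * (v i \<bullet> v i - 1) + a j * (v j \<bullet> v j) + (if i = j then a j else 0)) / 2)"
    proof (intro sum.cong refl)
      fix j assume "j \<in> ?I"
      then have v_ij: "v i \<bullet> v j = ((v i \<bullet> v i) + (v j \<bullet> v j) - of_bool (i \<noteq> j)) / 2"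
        by (rule inner_v[OF i])
      show "a j * (v i \<bullet> v j) =
          (a j * (v i \<bullet> v i - 1) + a j * (v j \<bullet> v j) + (if i = j then a j else 0)) / 2"
      proof (cases "i = j")
        case True
        then show ?thesis by (simp add: algebra_simps)
      next
        case False
        then show ?thesis unfolding v_ij by (simp add: algebra_simps)
      qed
    qed
    also have "\<dots> = ((\<Sum>j\<in>?I. a j) * (v i \<bullet> v i - 1) + (\<Sum>j\<in>?I. a j * (v j \<bullet> v j)) + a i) / 2"
      using i by (simp add: sum.distrib sum_distrib_right flip: sum_divide_distrib)
    finally show ?thesis using a0 by simp
  qed
  have "0 = v i \<bullet> (\<Sum>j\<in>?I. a j *\<^sub>R v j)" for i
    using av by simp
  then have zero: "(\<Sum>j\<in>?I. a j * (v j \<bullet> v j)) + a i = 0" if "i \<in> ?I" for i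
    using row[OF that] by (simp add: inner_sum_right)
  let ?q = "\<Sum>j\<in>?I. a j * (v j \<bullet> v j)"
  have a_eq: "a k = - ?q" if "k \<in> ?I" for k
    using zero[OF that] by linarith
  then have "(\<Sum>k\<in>?I. a k) = (\<Sum>k\<in>?I. - ?q)"
    by (intro sum.cong) auto
  then have "real d * ?q = 0"
    using a0 by simp
  then show ?thesis
    using a_eq[OF i] d_ge_2 by simp
qed

lemma affine_independent_vertices: "\<not> affine_dependent (v ` {1..d})"
proof
  assume "affine_dependent (v ` {1..d})"
  then obtain U where U: "sum U (v ` {1..d}) = 0" "\<exists>x\<in>v ` {1..d}. U x \<noteq> 0"
      "(\<Sum>x\<in>v ` {1..d}. U x *\<^sub>R x) = 0"
    by (subst (asm) affine_dependent_explicit_finite) auto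
  then obtain i where "i \<in> {1..d}" "U (v i) \<noteq> 0" by blast
  then show False
    using vertices_independent[of "U \<circ> v" i] U(1,3)
    unfolding sum.reindex[OF inj_vertices] by (simp add: o_def)
qed

lemma affine_hull_vertices: "affine hull (v ` {1..d}) = UNIV"
  using d_ge_2 dim card_image[OF inj_vertices]
  by (intro affine_independent_span_eq[OF affine_independent_vertices]) auto

text \<open>Two coordinate vectors of one point differ by an affine relation among the vertices,
  which \<open>vertices_independent\<close> makes trivial; this settles uniqueness in
  \<open>bary\<close>.\<close>

lemma bary_eqI:
  assumes "\<And>i. i \<notin> {1..d} \<Longrightarrow> a i = 0" and "(\<Sum>i\<in>{1..d}. a i) = 1"
    and "(\<Sum>i\<in>{1..d}. a i *\<^sub>R v i) = x"
  shows "bary d v x = a"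
  unfolding bary_def
proof (rule the_equality)
  fix b
  assume b: "(\<forall>i. i \<notin> {1..d} \<longrightarrow> b i = 0) \<and> (\<Sum>i\<in>{1..d}. b i) = 1 \<and> (\<Sum>i\<in>{1..d}. b i *\<^sub>R v i) = x"
  show "b = a"
  proof
    fix i
    show "b i = a i"
    proof (cases "i \<in> {1..d}")
      case True
      then show ?thesis
        using vertices_independent[of "\<lambda>i. b i - a i" i] b assms
        by (simp add: sum_subtractf algebra_simps)
    next
      case False
      then show ?thesis using b assms(1) by simp
    qed
  qed
qed (use assms in auto)

lemma bary_sum_scaleR: "(\<Sum>i\<in>{1..d}. bary d v x i *\<^sub>R v i) = x"
  and bary_sum: "(\<Sum>i\<in>{1..d}. bary d v x i) = 1"
proof -
  have "x \<in> affine hull (v ` {1..d})"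
    unfolding affine_hull_vertices by simp
  then obtain u where u: "sum u (v ` {1..d}) = 1" "(\<Sum>y\<in>v ` {1..d}. u y *\<^sub>R y) = x"
    by (subst (asm) affine_hull_finite) auto
  \<comment> \<open>The value 0 outside the index range is the normalisation that
    \<open>bary\<close> demands.\<close>
  define a where "a i = (if i \<in> {1..d} then u (v i) else 0)" for i
  have a_outside: "a i = 0" if "i \<notin> {1..d}" for i
    unfolding a_def if_not_P[OF that] ..
  have a: "(\<Sum>i\<in>{1..d}. a i) = 1"
      "(\<Sum>i\<in>{1..d}. a i *\<^sub>R v i) = x"
    using u unfolding sum.reindex[OF inj_vertices] by (simp_all add: a_def o_def)
  have "bary d v x = a" by (rule bary_eqI[OF a_outside a])
  then show "(\<Sum>i\<in>{1..d}. bary d v x i *\<^sub>R v i) = x" and "(\<Sum>i\<in>{1..d}. bary d v x i) = 1"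
    using a by simp_all
qed

lemma point_of_bary:
  assumes "\<And>i. i \<in> {1..d} \<Longrightarrow> 0 \<le> a i" and "(\<Sum>i\<in>{1..d}. a i) = 1"
  obtains x where "x \<in> simplex_body d v" and "\<And>i. i \<in> {1..d} \<Longrightarrow> bary d v x i = a i"
proof
  let ?x = "\<Sum>i\<in>{1..d}. a i *\<^sub>R v i"
  show "?x \<in> simplex_body d v"
    unfolding simplex_body_def using assms
    by (intro convex_sum) (auto intro: hull_inc)
  have "bary d v ?x = (\<lambda>i. if i \<in> {1..d} then a i else 0)"
    by (rule bary_eqI) (use assms in auto)
  then show "bary d v ?x i = a i" if "i \<in> {1..d}" for i
    using that by simp
qed

lemma bary_nonneg:
  assumes "x \<in> simplex_body d v" and "i \<in> {1..d}"
  shows "0 \<le> bary d v x i"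
proof -
  obtain u where u: "\<forall>y\<in>v ` {1..d}. 0 \<le> u y" "sum u (v ` {1..d}) = 1"
      "(\<Sum>y\<in>v ` {1..d}. u y *\<^sub>R y) = x"
    using assms(1) unfolding simplex_body_def by (subst (asm) convex_hull_finite) auto
  have "bary d v x = (\<lambda>i. if i \<in> {1..d} then u (v i) else 0)"
    using u(2,3) unfolding sum.reindex[OF inj_vertices]
    by (intro bary_eqI) (simp_all del: atLeastAtMost_iff)
  then show ?thesis using u assms(2) by auto
qed

lemma bary_le_1:
  assumes "x \<in> simplex_body d v" and "i \<in> {1..d}"
  shows "bary d v x i \<le> 1"
  using member_le_sum[of i "{1..d}" "bary d v x"] bary_nonneg[OF assms(1)] bary_sum[of x] assms(2)
  by auto

lemma vertex_in_simplex: "j \<in> {1..d} \<Longrightarrow> v j \<in> simplex_body d v"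
  by (auto simp: simplex_body_def intro: hull_inc)

section \<open>Preference sets as thresholds on one coordinate\<close>

text \<open>A functional that is constant on the facet opposite \<open>v j\<close> is an affine
  function of coordinate \<open>j\<close> alone. Properness together with \<open>v j \<in> H\<close>
  fixes its direction: it decreases towards \<open>v j\<close>.\<close>

lemma halfspace_threshold:
  assumes j: "j \<in> {1..d}" and H: "halfspace_parallel_to_facet d v j H"
    and proper: "simplex_body d v \<inter> H \<subset> simplex_body d v" and vH: "v j \<in> H"
  obtains c where "0 < c" and "c \<le> 1"
    and "simplex_body d v \<inter> H = {x \<in> simplex_body d v. c \<le> bary d v x j}"
proof -
  obtain a c t where H_eq: "H = {x. a \<bullet> x \<le> c}"
    and par: "{x. a \<bullet> x = c} = (\<lambda>x. t + x) ` (affine hull (facet d v j))"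
    using H unfolding halfspace_parallel_to_facet_def affine_parallel_def by blast
  \<comment> \<open>\<open>\<beta>\<close> is the value at every vertex of the facet, since
    translation by \<open>t\<close> carries the facet into the boundary hyperplane;
    \<open>\<gamma>\<close> is the value at \<open>v j\<close>.\<close>
  define \<beta> \<gamma> where "\<beta> = c - a \<bullet> t" and "\<gamma> = a \<bullet> v j"
  have other: "a \<bullet> v k = \<beta>" if "k \<in> {1..d}" "k \<noteq> j" for k
  proof -
    have "v k \<in> affine hull (facet d v j)"
      unfolding facet_def affine_hull_convex_hull using that by (intro hull_inc) auto
    then have "t + v k \<in> {x. a \<bullet> x = c}"
      unfolding par by blast
    then show ?thesis by (simp add: \<beta>_def inner_add_right)
  qed
  have inner_bary: "a \<bullet> x = \<beta> + (\<gamma> - \<beta>) * bary d v x j" for x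
  proof -
    have "a \<bullet> x = (\<Sum>k\<in>{1..d}. bary d v x k * (a \<bullet> v k))"
      by (subst (1) bary_sum_scaleR[of x, symmetric]) (simp add: inner_sum_right)
    also have "\<dots> = (\<Sum>k\<in>{1..d}. bary d v x k * \<beta> + (if k = j then bary d v x k * (\<gamma> - \<beta>) else 0))"
      using other by (intro sum.cong) (auto simp: \<gamma>_def algebra_simps)
    also have "\<dots> = \<beta> + (\<gamma> - \<beta>) * bary d v x j"
      using j bary_sum[of x] by (simp add: sum.distrib flip: sum_distrib_right)
    finally show ?thesis .
  qed
  have \<gamma>c: "\<gamma> \<le> c" using vH by (simp add: H_eq \<gamma>_def)
  obtain y where y: "y \<in> simplex_body d v" "c < \<beta> + (\<gamma> - \<beta>) * bary d v y j"
    using proper inner_bary by (force simp: H_eq)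
  have y01: "0 \<le> bary d v y j" "bary d v y j \<le> 1"
    using y j bary_nonneg bary_le_1 by auto
  \<comment> \<open>Otherwise the functional would be largest on the simplex at \<open>v j\<close>,
    where it is at most \<open>c\<close>, against properness.\<close>
  have lt: "\<gamma> < \<beta>"
  proof (rule ccontr)
    assume "\<not> \<gamma> < \<beta>"
    then have "(\<gamma> - \<beta>) * bary d v y j \<le> \<gamma> - \<beta>"
      using y01 by (intro mult_left_le) auto
    then show False using y \<gamma>c by linarith
  qed
  have "(\<gamma> - \<beta>) * bary d v y j \<le> 0"
    using lt y01 by (intro mult_nonpos_nonneg) auto
  then have "c < \<beta>" using y by linarith
  show thesis
  proof (rule that[of "(\<beta> - c) / (\<beta> - \<gamma>)"])
    show "0 < (\<beta> - c) / (\<beta> - \<gamma>)" "(\<beta> - c) / (\<beta> - \<gamma>) \<le> 1"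
      using lt \<gamma>c \<open>c < \<beta>\<close> by auto
    have "a \<bullet> x \<le> c \<longleftrightarrow> (\<beta> - c) / (\<beta> - \<gamma>) \<le> bary d v x j" for x
      using lt by (simp add: inner_bary field_simps)
    then show "simplex_body d v \<inter> H =
        {x \<in> simplex_body d v. (\<beta> - c) / (\<beta> - \<gamma>) \<le> bary d v x j}"
      by (auto simp: H_eq)
  qed
qed

lemma thresholds_of_preferences:
  assumes "halfspace_preferences d v P"
  obtains c where "\<And>i j. i \<in> {1..d} \<Longrightarrow> j \<in> {1..d} \<Longrightarrow> 0 < c i j \<and> c i j \<le> 1"
    and "\<And>i j. i \<in> {1..d} \<Longrightarrow> j \<in> {1..d} \<Longrightarrow>
      P i j = {x \<in> simplex_body d v. c i j \<le> bary d v x j}"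
proof -
  have "\<exists>c. 0 < c \<and> c \<le> 1 \<and> P i j = {x \<in> simplex_body d v. c \<le> bary d v x j}"
    if ij: "i \<in> {1..d}" "j \<in> {1..d}" for i j
  proof -
    have "P i j \<subset> simplex_body d v" "v j \<in> P i j"
        "\<exists>H. halfspace_parallel_to_facet d v j H \<and> P i j = simplex_body d v \<inter> H"
      using assms ij unfolding halfspace_preferences_def by simp_all
    then obtain H where H: "halfspace_parallel_to_facet d v j H" "P i j = simplex_body d v \<inter> H"
        "simplex_body d v \<inter> H \<subset> simplex_body d v" "v j \<in> H"
      by auto
    obtain c where "0 < c" "c \<le> 1"
        "simplex_body d v \<inter> H = {x \<in> simplex_body d v. c \<le> bary d v x j}"
      by (rule halfspace_threshold[OF ij(2) H(1,3,4)])
    then show ?thesis using H(2) by auto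
  qed
  then show thesis using that by metis
qed

text \<open>If the sum \<open>?s\<close> exceeded 1, the point with coordinates
  \<open>c j / ?s\<close> would lie below all thresholds and be uncovered.\<close>

lemma sum_thresholds_le_1:
  fixes c :: "nat \<Rightarrow> real"
  assumes pos: "\<And>j. j \<in> {1..d} \<Longrightarrow> 0 < c j"
    and cover: "\<And>x. x \<in> simplex_body d v \<Longrightarrow> \<exists>j\<in>{1..d}. c j \<le> bary d v x j"
  shows "(\<Sum>j\<in>{1..d}. c j) \<le> 1"
proof (rule ccontr)
  assume "\<not> ?thesis"
  then have s: "1 < (\<Sum>j\<in>{1..d}. c j)" (is "1 < ?s") by simp
  have "0 \<le> c j / ?s" if "j \<in> {1..d}" for j
    using pos[OF that] s by simp
  moreover have "(\<Sum>j\<in>{1..d}. c j / ?s) = 1"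
    using s by (simp flip: sum_divide_distrib)
  ultimately obtain x where x: "x \<in> simplex_body d v"
      "\<And>j. j \<in> {1..d} \<Longrightarrow> bary d v x j = c j / ?s"
    by (rule point_of_bary[of "\<lambda>j. c j / ?s"]) blast+
  obtain j where j: "j \<in> {1..d}" "c j \<le> c j / ?s"
    using cover[OF x(1)] x(2) by auto
  then have "c j * ?s \<le> c j" using s by (simp add: field_simps)
  then show False using mult_strict_left_mono[OF s pos[OF j(1)]] by simp
qed

text \<open>When \<open>x\<close> misses the threshold, the nearest point that meets it lies on the segment from
  \<open>x\<close> to \<open>v j\<close>: the mass added at \<open>j\<close> is at least the mass removed anywhere else.\<close>

lemma thickening_threshold:
  assumes x: "x \<in> simplex_body d v" and j: "j \<in> {1..d}" and c1: "c \<le> 1" and "0 \<le> \<epsilon>"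
    and le: "c \<le> bary d v x j + \<epsilon>"
  shows "x \<in> thickening d v \<epsilon> {x \<in> simplex_body d v. c \<le> bary d v x j}"
proof -
  let ?b = "bary d v x" and ?S = "{x \<in> simplex_body d v. c \<le> bary d v x j}"
  have ne: "{1..d} \<noteq> {}" using d_ge_2 by simp
  have "\<exists>y\<in>?S. bary_dist d v x y \<le> \<epsilon>"
  proof (cases "c \<le> ?b j")
    case True
    have "bary_dist d v x x \<le> \<epsilon>"
      unfolding bary_dist_def using ne \<open>0 \<le> \<epsilon>\<close> by simp
    then show ?thesis using True x by blast
  next
    case False
    then have b1: "?b j < 1" using c1 by linarith
    \<comment> \<open>The fraction of the way to \<open>v j\<close> at which coordinate
      \<open>j\<close> reaches exactly \<open>c\<close>.\<close>
    define s where "s = (c - ?b j) / (1 - ?b j)"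
    have s: "0 \<le> s" "s \<le> 1" using False b1 c1 by (auto simp: s_def)
    have s_mult: "s * (1 - ?b j) = c - ?b j" using b1 by (simp add: s_def)
    have rest: "?b k \<le> 1 - ?b j" if k: "k \<in> {1..d}" "k \<noteq> j" for k
    proof -
      have "?b k + ?b j = (\<Sum>i\<in>{k, j}. ?b i)" using k by simp
      also have "\<dots> \<le> (\<Sum>i\<in>{1..d}. ?b i)"
        using k j bary_nonneg[OF x] by (intro sum_mono2) auto
      finally show ?thesis using bary_sum[of x] by simp
    qed
    define a where "a k = (1 - s) * ?b k + s * of_bool (k = j)" for k
    have a0: "0 \<le> a k" if "k \<in> {1..d}" for k
      using s bary_nonneg[OF x that] by (simp add: a_def)
    have a1: "(\<Sum>k\<in>{1..d}. a k) = 1"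
      using j bary_sum[of x] by (simp add: a_def sum.distrib of_bool_def flip: sum_distrib_left)
    obtain y where y: "y \<in> simplex_body d v" "\<And>k. k \<in> {1..d} \<Longrightarrow> bary d v y k = a k"
      using point_of_bary[OF a0 a1] by blast
    have "\<bar>?b k - bary d v y k\<bar> \<le> \<epsilon>" if k: "k \<in> {1..d}" for k
    proof (cases "k = j")
      case True
      then have "bary d v y k - ?b k = c - ?b j"
        using s_mult y(2)[OF k] by (simp add: a_def algebra_simps)
      then show ?thesis using True False le by linarith
    next
      case kj: False
      then have "?b k - bary d v y k = s * ?b k"
        using y(2)[OF k] by (simp add: a_def algebra_simps)
      moreover have "0 \<le> s * ?b k" using s bary_nonneg[OF x k] by simp
      moreover have "s * ?b k \<le> s * (1 - ?b j)"
        using s rest[OF k kj] by (intro mult_left_mono)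
      ultimately show ?thesis using s_mult le by linarith
    qed
    then have "bary_dist d v x y \<le> \<epsilon>"
      unfolding bary_dist_def using ne by (subst Max_le_iff) auto
    moreover have "bary d v y j = c"
      using s_mult y(2)[OF j] by (simp add: a_def algebra_simps)
    ultimately show ?thesis using y(1) by auto
  qed
  then obtain y where y: "y \<in> ?S" "bary_dist d v x y \<le> \<epsilon>" by blast
  have "0 \<le> bary_dist d v x z" for z
    unfolding bary_dist_def using ne by (subst Max_ge_iff) auto
  then have "(INF z\<in>?S. bary_dist d v x z) \<le> bary_dist d v x y"
    using y(1) by (intro cINF_lower bdd_belowI[of _ 0]) auto
  then show ?thesis using y unfolding thickening_def by force
qed

section \<open>From measurements to a division\<close>

text \<open>Membership in \<open>P i j\<close> depends on coordinate \<open>j\<close> only, so any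
  point with the right coordinate serves as a query.\<close>

definition grid_point :: "nat \<Rightarrow> nat \<Rightarrow> nat \<Rightarrow> 'a" where
  "grid_point K j k = (SOME x. x \<in> simplex_body d v \<and> bary d v x j = real k / real K)"

lemma grid_point:
  assumes j: "j \<in> {1..d}" and k: "k \<le> K" "0 < K"
  shows "grid_point K j k \<in> simplex_body d v \<and> bary d v (grid_point K j k) j = real k / real K"
  unfolding grid_point_def
proof (rule someI_ex)
  \<comment> \<open>Some index other than \<open>j\<close>, to carry the remaining mass.\<close>
  define i where "i = (if j = 1 then 2 else 1 :: nat)"
  have i: "i \<in> {1..d}" "i \<noteq> j" using d_ge_2 j by (auto simp: i_def)
  define a where "a = (\<lambda>_. 0 :: real)(j := real k / real K, i := 1 - real k / real K)"
  have "real k / real K \<le> 1" using k by simp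
  then have a0: "0 \<le> a m" if "m \<in> {1..d}" for m
    by (simp add: a_def)
  have "(\<Sum>m\<in>{1..d}. a m) = (\<Sum>m\<in>{i, j}. a m)"
    using i j by (intro sum.mono_neutral_right) (auto simp: a_def)
  then have a1: "(\<Sum>m\<in>{1..d}. a m) = 1"
    using i(2) by (simp add: a_def)
  obtain x where "x \<in> simplex_body d v" "\<And>m. m \<in> {1..d} \<Longrightarrow> bary d v x m = a m"
    using point_of_bary[OF a0 a1] by blast
  then show "\<exists>x. x \<in> simplex_body d v \<and> bary d v x j = real k / real K"
    using i(2) j by (intro exI[of _ x]) (simp add: a_def)
qed

text \<open>Agent \<open>i < d\<close> is measured only against the pieces \<open>j < d\<close>; the threshold for piece \<open>d\<close> is
  replaced by the bound that the covering condition \<open>(\<Sum>j. c i j) \<le> 1\<close> puts on it. Since the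
  measurements \<open>l (i, j)\<close> round down, this bound is nonnegative.\<close>

definition completed :: "nat \<Rightarrow> (nat \<times> nat \<Rightarrow> nat) \<Rightarrow> nat \<Rightarrow> nat \<Rightarrow> int" where
  "completed K l i j =
     (if j = d then int K - (\<Sum>k\<in>{1..<d}. int (l (i, k))) else int (l (i, j)))"

text \<open>Stated through the table \<open>l\<close> alone, without the preference sets, so that a
  leaf of the tree can output such a point.\<close>

definition secretive_division :: "nat \<Rightarrow> (nat \<times> nat \<Rightarrow> nat) \<Rightarrow> 'a \<Rightarrow> bool" where
  "secretive_division K l x \<longleftrightarrow> x \<in> simplex_body d v \<and>
     (\<forall>k\<in>{1..d}. \<exists>m. bij_betw m {1..<d} ({1..d} - {k}) \<and>
        (\<forall>i\<in>{1..<d}. real_of_int (completed K l i (m i)) \<le> real K * bary d v x (m i)))"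

lemma secretive_division_in_simplex: "secretive_division K l x \<Longrightarrow> x \<in> simplex_body d v"
  by (simp add: secretive_division_def)

lemma indices_split: "{1..d} = insert d {1..<d}" "d \<notin> {1..<d}"
  using d_ge_2 by auto

text \<open>The completed rows are nonnegative with sum \<open>K\<close>, so they can serve as costs
  in \<open>ex_fair_for_undecided_agent\<close>; dividing the resulting shares by \<open>K\<close>
  gives barycentric coordinates.\<close>

lemma ex_secretive_division:
  assumes K: "0 < K"
    and l: "\<And>i. i \<in> {1..<d} \<Longrightarrow> (\<Sum>k\<in>{1..<d}. int (l (i, k))) \<le> int K"
  shows "\<exists>x. secretive_division K l x"
proof -
  have sum_completed: "(\<Sum>j\<in>{1..d}. completed K l i j) = int K" for i
  proof -
    have "(\<Sum>j\<in>{1..<d}. completed K l i j) = (\<Sum>k\<in>{1..<d}. int (l (i, k)))"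
      by (intro sum.cong) (auto simp: completed_def)
    then show ?thesis
      unfolding indices_split(1) using indices_split(2) by (simp add: completed_def)
  qed
  have completed_nonneg: "0 \<le> completed K l i j" if "i \<in> {1..<d}" "j \<in> {1..d}" for i j
    using l[OF that(1)] by (simp add: completed_def)
  have cards: "card {1..d} = Suc (card {1..<d})" "{1..<d} \<noteq> {}" using d_ge_2 by auto
  have "\<exists>y :: nat \<Rightarrow> real. (\<forall>j\<in>{1..d}. 0 \<le> y j) \<and> (\<Sum>j\<in>{1..d}. y j) = real_of_int (int K) \<and>
      (\<forall>k\<in>{1..d}. \<exists>m. bij_betw m {1..<d} ({1..d} - {k}) \<and>
        (\<forall>i\<in>{1..<d}. real_of_int (completed K l i (m i)) \<le> y (m i)))"
  proof (rule ex_fair_for_undecided_agent[OF _ _ cards])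
    show "0 \<le> completed K l i j" if "i \<in> {1..<d}" "j \<in> {1..d}" for i j
      by (rule completed_nonneg[OF that])
    show "(\<Sum>j\<in>{1..d}. completed K l i j) = int K" for i
      by (rule sum_completed)
  qed simp_all
  then obtain y :: "nat \<Rightarrow> real" where y: "\<And>j. j \<in> {1..d} \<Longrightarrow> 0 \<le> y j" "(\<Sum>j\<in>{1..d}. y j) = real K"
    and matchings: "\<And>k. k \<in> {1..d} \<Longrightarrow> \<exists>m. bij_betw m {1..<d} ({1..d} - {k}) \<and>
      (\<forall>i\<in>{1..<d}. real_of_int (completed K l i (m i)) \<le> y (m i))"
    unfolding of_int_of_nat_eq by blast
  have y0: "0 \<le> y j / real K" if "j \<in> {1..d}" for j using y(1)[OF that] by simp
  have y1: "(\<Sum>j\<in>{1..d}. y j / real K) = 1"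
    using y(2) K by (simp flip: sum_divide_distrib)
  obtain x where x: "x \<in> simplex_body d v" "\<And>j. j \<in> {1..d} \<Longrightarrow> bary d v x j = y j / real K"
    using point_of_bary[OF y0 y1] by blast
  have "\<exists>m. bij_betw m {1..<d} ({1..d} - {k}) \<and>
      (\<forall>i\<in>{1..<d}. real_of_int (completed K l i (m i)) \<le> real K * bary d v x (m i))"
    if k: "k \<in> {1..d}" for k
  proof -
    obtain m where m: "bij_betw m {1..<d} ({1..d} - {k})"
        "\<And>i. i \<in> {1..<d} \<Longrightarrow> real_of_int (completed K l i (m i)) \<le> y (m i)"
      using matchings[OF k] by blast
    have "real K * bary d v x (m i) = y (m i)" if "i \<in> {1..<d}" for i
      using x(2)[of "m i"] bij_betwE[OF m(1)] that K by auto
    then show ?thesis using m by (intro exI[of _ m]) simp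
  qed
  then show ?thesis using x(1) unfolding secretive_division_def by blast
qed

text \<open>By covering, agent \<open>d\<close> accepts some piece \<open>k\<close> at
  \<open>x\<close> exactly. The others share the remaining pieces, each missing its threshold by at
  most one grid step \<open>1 / real K\<close>.\<close>

lemma eps_fair_of_secretive_division:
  assumes K: "0 < K" "1 / real K \<le> \<epsilon>"
    and cover: "preference_sets d v P"
    and c: "\<And>i j. i \<in> {1..d} \<Longrightarrow> j \<in> {1..d} \<Longrightarrow> c i j \<le> 1"
    and P: "\<And>i j. i \<in> {1..d} \<Longrightarrow> j \<in> {1..d} \<Longrightarrow>
      P i j = {x \<in> simplex_body d v. c i j \<le> bary d v x j}"
    and c_le: "\<And>i j. i \<in> {1..<d} \<Longrightarrow> j \<in> {1..d} \<Longrightarrow>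
      c i j * real K \<le> real_of_int (completed K l i j) + 1"
    and x: "secretive_division K l x"
  shows "eps_fair_division d v \<epsilon> P x"
proof -
  have xs: "x \<in> simplex_body d v" by (rule secretive_division_in_simplex[OF x])
  have d_mem: "d \<in> {1..d}" using d_ge_2 by simp
  then have "x \<in> (\<Union>j\<in>{1..d}. P d j)"
    using cover xs unfolding preference_sets_def by blast
  then obtain k where k: "k \<in> {1..d}" "x \<in> P d k" by blast
  obtain m where m: "bij_betw m {1..<d} ({1..d} - {k})"
      "\<And>i. i \<in> {1..<d} \<Longrightarrow> real_of_int (completed K l i (m i)) \<le> real K * bary d v x (m i)"
    using x k(1) unfolding secretive_division_def by blast
  have m_mem: "m i \<in> {1..d}" if "i \<in> {1..<d}" for i
    using bij_betwE[OF m(1)] that by blast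
  define \<sigma> where "\<sigma> i = (if i = d then k else if i \<in> {1..<d} then m i else i)" for i
  have "bij_betw \<sigma> {1..<d} ({1..d} - {k})"
    using m(1) by (subst bij_betw_cong[of _ _ m]) (auto simp: \<sigma>_def)
  moreover have "bij_betw \<sigma> {d} {k}"
    by (simp add: bij_betw_def \<sigma>_def)
  ultimately have bij: "bij_betw \<sigma> ({1..<d} \<union> {d}) (({1..d} - {k}) \<union> {k})"
    by (rule bij_betw_combine) blast
  have "{1..<d} \<union> {d} = {1..d}" using d_ge_2 by auto
  moreover have "({1..d} - {k}) \<union> {k} = {1..d}" using k(1) by blast
  ultimately have "bij_betw \<sigma> {1..d} {1..d}" using bij by simp
  moreover have "\<sigma> i = i" if "i \<notin> {1..d}" for i
    using that d_mem by (auto simp: \<sigma>_def)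
  ultimately have "\<sigma> permutes {1..d}" by (rule bij_imp_permutes)
  moreover have "x \<in> thickening d v \<epsilon> (P i (\<sigma> i))" if i: "i \<in> {1..d}" for i
  proof -
    have \<sigma>i: "\<sigma> i \<in> {1..d}"
      using permutes_in_image[OF \<open>\<sigma> permutes {1..d}\<close>] i by blast
    have \<epsilon>: "0 \<le> \<epsilon>" using K(2) by (rule order.trans[rotated]) simp
    have "c i (\<sigma> i) \<le> bary d v x (\<sigma> i) + \<epsilon>"
    proof (cases "i = d")
      case True
      then show ?thesis using k P[OF d_mem k(1)] \<epsilon> by (simp add: \<sigma>_def)
    next
      case False
      then have i': "i \<in> {1..<d}" using i by auto
      then have "c i (m i) * real K \<le> real K * bary d v x (m i) + 1"
        using c_le[OF i' m_mem[OF i']] m(2)[OF i'] by linarith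
      then have "c i (m i) \<le> bary d v x (m i) + 1 / real K"
        using K(1) by (simp add: field_simps)
      then show ?thesis using K(2) i' by (simp add: \<sigma>_def)
    qed
    then show ?thesis
      unfolding P[OF i \<sigma>i] by (rule thickening_threshold[OF xs \<sigma>i c[OF i \<sigma>i] \<epsilon>])
  qed
  ultimately show ?thesis
    using xs unfolding eps_fair_division_def by blast
qed

section \<open>The algorithm, its query count and its correctness\<close>

text \<open>\<open>v 1\<close> is a placeholder at leaves that no allowed collection reaches;
  admissibility concerns every leaf.\<close>

definition division_algorithm :: "nat \<Rightarrow> 'a algorithm" where
  "division_algorithm M = measure_all M (grid_point (2 ^ M))
     (\<lambda>l. if \<exists>x. secretive_division (2 ^ M) l x then SOME x. secretive_division (2 ^ M) l x else v 1)
     (List.product [1..<d] [1..<d]) (\<lambda>_. 0)"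

lemma admissible_division_algorithm: "admissible d v (division_algorithm M)"
  unfolding division_algorithm_def
proof (rule admissible_measure_all)
  fix l
  let ?sd = "secretive_division (2 ^ M) l"
  show "(if \<exists>x. ?sd x then SOME x. ?sd x else v 1) \<in> simplex_body d v"
  proof (cases "\<exists>x. ?sd x")
    case True
    then show ?thesis using secretive_division_in_simplex[OF someI_ex[OF True]] by simp
  next
    case False
    then show ?thesis using vertex_in_simplex[of 1] d_ge_2 by simp
  qed
qed (use grid_point in auto)

lemma division_algorithm_correct:
  assumes pref: "preference_sets d v P" and half: "halfspace_preferences d v P"
    and M: "1 / 2 ^ M \<le> \<epsilon>"
  shows "num_queries P (division_algorithm M) = (d - 1)\<^sup>2 * M"
    and "eps_fair_division d v \<epsilon> P (result P (division_algorithm M))"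
proof -
  obtain c where c01: "\<And>i j. i \<in> {1..d} \<Longrightarrow> j \<in> {1..d} \<Longrightarrow> 0 < c i j \<and> c i j \<le> 1"
    and P: "\<And>i j. i \<in> {1..d} \<Longrightarrow> j \<in> {1..d} \<Longrightarrow>
      P i j = {x \<in> simplex_body d v. c i j \<le> bary d v x j}"
    using thresholds_of_preferences[OF half] by blast
  let ?K = "2 ^ M :: nat"
  let ?out = "\<lambda>l. if \<exists>x. secretive_division ?K l x then SOME x. secretive_division ?K l x else v 1"
  let ?qs = "List.product [1..<d] [1..<d]"
  \<comment> \<open>Thresholds are rescaled by \<open>2 ^ M\<close>, so that one grid step has
    length 1.\<close>
  have "\<exists>l. (\<forall>i j. (i, j) \<in> set ?qs \<longrightarrow>
          real (l (i, j)) < c i j * 2 ^ M \<and> c i j * 2 ^ M \<le> real (l (i, j)) + 1) \<and>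
        (\<forall>q. q \<notin> set ?qs \<longrightarrow> l q = 0) \<and>
        result P (measure_all M (grid_point ?K) ?out ?qs (\<lambda>_. 0)) = ?out l \<and>
        num_queries P (measure_all M (grid_point ?K) ?out ?qs (\<lambda>_. 0)) = length ?qs * M"
  proof (rule measure_all_thresholds)
    show "distinct ?qs" by (simp add: distinct_product)
    fix i j assume "(i, j) \<in> set ?qs"
    then have ij: "i \<in> {1..d}" "j \<in> {1..d}" by auto
    then show "0 < c i j * 2 ^ M \<and> c i j * 2 ^ M \<le> 2 ^ M"
      using c01[of i j] by simp
    show "grid_point ?K j k \<in> P i j \<longleftrightarrow> c i j * 2 ^ M \<le> real k" if "k \<le> 2 ^ M" for k
      using grid_point[OF ij(2) that] P[OF ij] by (simp add: pos_le_divide_eq)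
  qed
  then obtain l where l: "\<And>i j. i \<in> {1..<d} \<Longrightarrow> j \<in> {1..<d} \<Longrightarrow>
        real (l (i, j)) < c i j * 2 ^ M \<and> c i j * 2 ^ M \<le> real (l (i, j)) + 1"
      "result P (division_algorithm M) = ?out l"
      "num_queries P (division_algorithm M) = length ?qs * M"
    unfolding division_algorithm_def by auto
  show "num_queries P (division_algorithm M) = (d - 1)\<^sup>2 * M"
    using l(3) by (simp add: power2_eq_square)
  have c_row: "c i d + (\<Sum>k\<in>{1..<d}. c i k) \<le> 1" if i: "i \<in> {1..d}" for i
  proof -
    have "(\<Sum>j\<in>{1..d}. c i j) \<le> 1"
    proof (rule sum_thresholds_le_1)
      show "0 < c i j" if "j \<in> {1..d}" for j using c01[OF i that] by simp
      fix x assume "x \<in> simplex_body d v"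
      then have "x \<in> (\<Union>j\<in>{1..d}. P i j)"
        using pref i unfolding preference_sets_def by blast
      then show "\<exists>j\<in>{1..d}. c i j \<le> bary d v x j"
        using P[OF i] by blast
    qed
    then show ?thesis
      unfolding indices_split(1) using indices_split(2) by simp
  qed
  \<comment> \<open>Lower ends round down, so their sum stays below that of the true thresholds,
    which covering bounds by \<open>1 - c i d\<close>.\<close>
  have l_row: "real_of_int (\<Sum>k\<in>{1..<d}. int (l (i, k))) \<le> (1 - c i d) * 2 ^ M"
    if i: "i \<in> {1..<d}" for i
  proof -
    have "real_of_int (\<Sum>k\<in>{1..<d}. int (l (i, k))) = (\<Sum>k\<in>{1..<d}. real (l (i, k)))"
      by simp
    also have "\<dots> \<le> (\<Sum>k\<in>{1..<d}. c i k * 2 ^ M)"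
      using l(1)[OF i] by (intro sum_mono) (simp add: less_imp_le)
    also have "\<dots> = (\<Sum>k\<in>{1..<d}. c i k) * 2 ^ M"
      by (simp add: sum_distrib_right)
    also have "\<dots> \<le> (1 - c i d) * 2 ^ M"
      using c_row[of i] i by (intro mult_right_mono) auto
    finally show ?thesis .
  qed
  have "(\<Sum>k\<in>{1..<d}. int (l (i, k))) \<le> int ?K" if i: "i \<in> {1..<d}" for i
  proof -
    have "(1 - c i d) * 2 ^ M \<le> 2 ^ M"
      using c01[of i d] i by simp
    then have "real_of_int (\<Sum>k\<in>{1..<d}. int (l (i, k))) \<le> 2 ^ M"
      using l_row[OF i] by linarith
    also have "2 ^ M = real_of_int (int ?K)" by simp
    finally show ?thesis by (simp only: of_int_le_iff)
  qed
  then have ex: "\<exists>x. secretive_division ?K l x"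
    by (intro ex_secretive_division) auto
  \<comment> \<open>For piece \<open>d\<close>, rounding the other entries down only raises the
    completed value, so errors do not add up along a row; for the other pieces the error is a single
    bisection cell.\<close>
  have c_le: "c i j * real ?K \<le> real_of_int (completed ?K l i j) + 1"
    if "i \<in> {1..<d}" "j \<in> {1..d}" for i j
  proof (cases "j = d")
    case True
    then show ?thesis using l_row[OF that(1)] by (simp add: completed_def algebra_simps)
  next
    case False
    then show ?thesis using l(1)[of i j] that by (simp add: completed_def)
  qed
  have "secretive_division ?K l (result P (division_algorithm M))"
    unfolding l(2) using ex someI_ex[OF ex] by simp
  then show "eps_fair_division d v \<epsilon> P (result P (division_algorithm M))"
    using M pref c01 P c_le by (intro eps_fair_of_secretive_division[where K = ?K and c = c]) auto
qed

end

theorem theorem4p1: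
  fixes d :: nat and v :: "nat \<Rightarrow> 'a::euclidean_space" and \<epsilon> :: real and n :: int
  assumes "d \<ge> 2" and "DIM('a) = d - 1" and "regular_simplex d v"
    and "\<epsilon> > 0" and "n = \<lceil>1 / \<epsilon>\<rceil>"
  shows "\<exists>alg :: 'a algorithm. admissible d v alg \<and>
           (\<forall>P. preference_sets d v P \<and> halfspace_preferences d v P \<longrightarrow>
              int (num_queries P alg)
                \<le> (int d - 1)\<^sup>2 * \<lceil>log 2 (real_of_int n * (real d - 1))\<rceil> \<and>
              eps_fair_division d v \<epsilon> P (result P alg))"
proof -
  interpret full_regular_simplex d v
    using assms by unfold_locales
  \<comment> \<open>The number of rounds per bisection. The logarithm is nonnegative by
    \<open>nd1\<close>, so \<open>nat\<close> does not truncate.\<close>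
  define M where "M = nat \<lceil>log 2 (real_of_int n * (real d - 1))\<rceil>"
  have "0 < n" using assms(4,5) by simp
  then have n1: "1 \<le> real_of_int n" by simp
  have d1: "1 \<le> real d - 1" using assms(1) by simp
  have nd: "real_of_int n \<le> real_of_int n * (real d - 1)"
    using mult_left_mono[OF d1, of "real_of_int n"] n1 by simp
  then have nd1: "1 \<le> real_of_int n * (real d - 1)"
    using n1 by linarith
  then have "0 \<le> log 2 (real_of_int n * (real d - 1))"
    by (simp add: zero_le_log_cancel_iff)
  then have M: "int M = \<lceil>log 2 (real_of_int n * (real d - 1))\<rceil>"
    unfolding M_def by (simp add: order.trans[OF _ ceiling_mono[of 0]])
  have "log 2 (real_of_int n * (real d - 1)) \<le> real M"
    using le_of_int_ceiling M by (metis of_int_of_nat_eq)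
  then have "real_of_int n * (real d - 1) \<le> 2 ^ M"
    using nd1 by (simp add: log_le_iff powr_realpow)
  \<comment> \<open>Chain: \<open>1 / \<epsilon> \<le> n \<le> n * (d - 1) \<le> 2 ^ M\<close>, so
    one grid step is at most \<open>\<epsilon>\<close>.\<close>
  then have "1 / \<epsilon> \<le> 2 ^ M"
    using nd assms(5) le_of_int_ceiling[of "1 / \<epsilon>"] by linarith
  then have \<epsilon>: "1 / 2 ^ M \<le> \<epsilon>"
    using assms(4) by (simp add: field_simps)
  have "int (num_queries P (division_algorithm M))
        \<le> (int d - 1)\<^sup>2 * \<lceil>log 2 (real_of_int n * (real d - 1))\<rceil> \<and>
      eps_fair_division d v \<epsilon> P (result P (division_algorithm M))"
    if "preference_sets d v P \<and> halfspace_preferences d v P" for P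
    using division_algorithm_correct[OF _ _ \<epsilon>, of P] that assms(1)
    by (simp add: of_nat_diff flip: M)
  then show ?thesis using admissible_division_algorithm by blast
qed

end
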